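(* Let $p$ be a prime and let $\varphi(x)=x^{p^2}+p^2x^{p^2+1}\in\mathbb{Z}[x]$. Let $f_\varphi(x)\in x+x^2\mathbb{Q}[[x]]$ be the Böttcher coordinate of $\varphi$, i.e. the unique such power series satisfying $\varphi(f_\varphi(x))=f_\varphi(x^{p^2})$, and write $$f_\varphi(x)=x\sum_{k=0}^\infty\frac{a_k}{k!}x^k,$$ where it is known that $a_k\in\mathbb{Z}$ for all $k$. Then for every $k$ that is a power of $p$ (that is, $k=p^r$ with $r\ge0$), $$a_k\equiv -1\pmod p.$$
   Context: Existence and uniqueness of the Böttcher coordinate (well known): if $K$ is a field of characteristic $0$, $m\ge2$, and $\varphi(x)\in x^m+x^{m+1}K[[x]]$, then there is a unique formal power series $f_\varphi(x)\in x+x^2K[[x]]$ with $\varphi\circ f_\varphi(x)=f_\varphi(x^m)$; it is called the (local) Böttcher coordinate of $\varphi$. The integrality $a_k\in\mathbb{Z}$ is a case of the following result: if $R$ is an integral domain of characteristic $0$, $m\ge 2$, and $\varphi(x)\in x^m+mx^{m+1}R[[x]]$, then $f_\varphi(x)=x\sum_{k\ge0} a_kx^k/k!$ with all $a_k\in R$. *)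

theory Defs
  imports "HOL-Computational_Algebra.Formal_Power_Series" "HOL-Number_Theory.Cong"
begin

text \<open>
  The composition \<open>oo\<close> of formal power series is the usual one only if the inner series has
  constant term 0. Both inner series below do, provided \<open>m > 0\<close>.
\<close>

definition is_bottcher_coordinate ::
    "nat \<Rightarrow> 'a::field_char_0 fps \<Rightarrow> 'a fps \<Rightarrow> bool" where
  "is_bottcher_coordinate m \<phi> f \<longleftrightarrow>
     fps_nth f 0 = 0 \<and> fps_nth f 1 = 1 \<and> \<phi> oo f = f oo (fps_X ^ m)"

text \<open>
  Existence and uniqueness hold for \<open>m \<ge> 2\<close> and \<open>\<phi> \<in> x^m + x^(m+1) K[[x]]\<close>; for other
  arguments the value is not meaningful.
\<close>

definition bottcher_coordinate ::
    "nat \<Rightarrow> 'a::field_char_0 fps \<Rightarrow> 'a fps" where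
  "bottcher_coordinate m \<phi> = (THE f. is_bottcher_coordinate m \<phi> f)"

end

theory Submission
  imports Defs "HOL-Computational_Algebra.Formal_Laurent_Series"
begin

text \<open>
  Write \<open>f = x g\<close> and \<open>m = p\<^sup>2\<close>, so that \<open>g(x)^m (1 + m f(x)) = g(x^m)\<close>, and let \<open>u = g'/g\<close>.
  The logarithmic derivative of this equation is
  \<open>(1 + m f) (u - x^(m-1) u(x^m)) = - f'\<close>. In terms of the coefficients of \<open>x^n/n!\<close>, the factor
  \<open>1 + m f\<close> is \<open>1\<close> modulo \<open>p\<close>, and \<open>x^(m-1) u(x^m)\<close> vanishes modulo \<open>p\<close> because
  \<open>(m k + m - 1)!/k!\<close> is divisible by \<open>p\<close>. Hence \<open>g' \<equiv> - g (x g)'\<close>, which is the differential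
  equation of the solution of \<open>g = exp (- x g)\<close>, whose coefficients are
  \<open>(-1)^n (n + 1)^(n-1)\<close>. At \<open>n = p^r\<close> this is \<open>-1\<close> modulo \<open>p\<close>.
\<close>

section \<open>Existence and uniqueness of the Boettcher coordinate\<close>

text \<open>By \<open>contr\<close>, the coefficient of index \<open>n\<close> of \<open>T g\<close>
  depends only on those of \<open>g\<close> below \<open>n\<close>. Each iteration of
  \<open>T\<close> therefore freezes one further coefficient, and the diagonal of the iterates is
  the fixed point.\<close>

lemma fps_contraction_ex1_fixpoint:
  fixes T :: "'a::zero fps \<Rightarrow> 'a fps" and c :: 'a
  assumes T0: "\<And>g. g $ 0 = c \<Longrightarrow> T g $ 0 = c"
    and contr: "\<And>g h n. g $ 0 = c \<Longrightarrow> h $ 0 = c \<Longrightarrow> 0 < n \<Longrightarrow>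
                  (\<And>k. k < n \<Longrightarrow> g $ k = h $ k) \<Longrightarrow> T g $ n = T h $ n"
  shows "\<exists>!g. g $ 0 = c \<and> T g = g"
proof -
  define s where "s n = (T ^^ n) (Abs_fps (\<lambda>_. c))" for n
  have s_Suc: "s (Suc n) = T (s n)" for n
    by (simp add: s_def)
  have s0: "s n $ 0 = c" for n
    by (induction n) (simp_all add: s_Suc T0, simp add: s_def)
  have step: "s (Suc n) $ k = s n $ k" if "k \<le> n" for n k
    using that
  proof (induction n arbitrary: k)
    case (Suc n)
    show ?case
    proof (cases "k = 0")
      case False
      then show ?thesis
        unfolding s_Suc[of "Suc n"] s_Suc[of n]
        using Suc by (intro contr) (auto simp: s0 s_Suc[symmetric])
    qed (simp add: s0)
  qed (simp add: s0)
  have stable: "s n $ k = s k $ k" if "k \<le> n" for n k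
    using that by (induction n rule: dec_induct) (simp_all add: step)
  define g where "g = Abs_fps (\<lambda>k. s k $ k)"
  have g0: "g $ 0 = c"
    by (simp add: g_def s0)
  have "T g $ n = g $ n" for n
  proof (cases n)
    case (Suc j)
    have "T g $ n = T (s j) $ n"
    proof (rule contr)
      show "g $ k = s j $ k" if "k < n" for k
        using stable[of k j] that Suc by (simp add: g_def)
    qed (simp_all add: g0 s0 Suc)
    then show ?thesis
      by (simp add: g_def Suc s_Suc)
  qed (simp add: g0 T0)
  then have "T g = g"
    by (simp add: fps_eq_iff)
  moreover have "h = g" if h: "h $ 0 = c" "T h = h" for h
  proof (rule fps_ext)
    show "h $ n = g $ n" for n
    proof (induction n rule: less_induct)
      case (less n)
      have "T h $ n = T g $ n" if "n > 0"
        using less that by (intro contr) (auto simp: g0 h)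
      then show ?case
        using h g0 \<open>T g = g\<close> by (cases "n = 0") auto
    qed
  qed
  ultimately show ?thesis
    using g0 by blast
qed

lemma fps_mult_nth_lowest:
  fixes D h :: "'a::comm_ring_1 fps"
  assumes "\<And>k. k < n \<Longrightarrow> D $ k = 0"
  shows "(D * h) $ n = D $ n * h $ 0"
proof -
  have "(D * h) $ n = (\<Sum>i=0..n. D $ i * h $ (n - i))"
    by (rule fps_mult_nth)
  also have "\<dots> = (\<Sum>i\<in>{n}. D $ i * h $ (n - i))"
    using assms by (intro sum.mono_neutral_right) auto
  finally show ?thesis by simp
qed

lemma fps_mult_nth_below:
  fixes D h :: "'a::comm_ring_1 fps"
  assumes "\<And>k. k < n \<Longrightarrow> D $ k = 0" "k < n"
  shows "(D * h) $ k = 0"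
  using assms by (simp add: fps_mult_nth_lowest)

text \<open>Telescoping: since the constant terms are 1, each of the \<open>m\<close> summands
  contributes the first difference \<open>g $ n - h $ n\<close> exactly once.\<close>

lemma fps_power_diff_nth:
  fixes g h :: "'a::comm_ring_1 fps"
  assumes "g $ 0 = 1" "h $ 0 = 1" and eq: "\<And>k. k < n \<Longrightarrow> g $ k = h $ k" and "k \<le> n"
  shows "(g ^ m - h ^ m) $ k = (if k < n then 0 else of_nat m * (g $ n - h $ n))"
  using \<open>k \<le> n\<close>
proof (induction m arbitrary: k)
  case (Suc m)
  have "g ^ Suc m - h ^ Suc m = (g - h) * g ^ m + (g ^ m - h ^ m) * h"
    by (simp add: algebra_simps)
  moreover have "((g - h) * g ^ m) $ k = (g - h) $ k * (g ^ m) $ 0"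
    using Suc.prems eq by (intro fps_mult_nth_lowest) auto
  moreover have "((g ^ m - h ^ m) * h) $ k = (g ^ m - h ^ m) $ k * h $ 0"
    using Suc.prems by (intro fps_mult_nth_lowest) (subst Suc.IH, auto)
  ultimately show ?case
    using Suc.IH[OF Suc.prems] Suc.prems assms
    by (auto simp: fps_power_zeroth algebra_simps)
qed simp

text \<open>The factor \<open>fps_X\<close> shifts indices by one, so even the coefficient of index
  \<open>n\<close> involves only coefficients of \<open>g\<close> below \<open>n\<close>.\<close>

lemma fps_compose_X_mult_cong:
  fixes g h \<psi> :: "'a::comm_ring_1 fps"
  assumes "g $ 0 = 1" "h $ 0 = 1" and eq: "\<And>k. k < n \<Longrightarrow> g $ k = h $ k" and "k \<le> n"
  shows "(\<psi> oo (fps_X * g)) $ k = (\<psi> oo (fps_X * h)) $ k"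
proof -
  have "((fps_X * g) ^ i) $ k = ((fps_X * h) ^ i) $ k" for i
  proof (cases "i = 0")
    case False
    have "(g ^ i) $ (k - i) = (h ^ i) $ (k - i)" if "i \<le> k"
    proof -
      have "k - i < n"
        using that False \<open>k \<le> n\<close> by linarith
      then show ?thesis
        using fps_power_diff_nth[of g h n "k - i" i] assms by simp
    qed
    then show ?thesis
      by (simp add: power_mult_distrib fps_X_power_mult_nth)
  qed simp
  then show ?thesis
    by (simp add: fps_compose_nth)
qed

lemma is_bottcher_coordinate_fps_X_mult_iff:
  fixes g \<psi> :: "'a::field_char_0 fps"
  assumes "0 < m"
  shows "is_bottcher_coordinate m (fps_X ^ m * \<psi>) (fps_X * g) \<longleftrightarrow>
           g $ 0 = 1 \<and> g ^ m * (\<psi> oo (fps_X * g)) = g oo fps_X ^ m"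
proof -
  have "(fps_X ^ m * \<psi>) oo (fps_X * g) = fps_X ^ m * (g ^ m * (\<psi> oo (fps_X * g)))"
    by (simp add: fps_compose_mult_distrib fps_X_power_compose power_mult_distrib mult.assoc)
  moreover have "(fps_X * g) oo fps_X ^ m = fps_X ^ m * (g oo fps_X ^ m)"
    using assms by (simp add: fps_compose_mult_distrib)
  ultimately show ?thesis
    by (simp add: is_bottcher_coordinate_def)
qed

text \<open>Every candidate has constant term 0, hence the form \<open>fps_X * g\<close>; after
  division by \<open>fps_X ^ m\<close> the equation for \<open>g\<close> is a fixed point
  problem.\<close>

theorem bottcher_coordinate_ex1:
  fixes \<psi> :: "'a::field_char_0 fps"
  assumes m: "2 \<le> m" and \<psi>0: "\<psi> $ 0 = 1"
  shows "\<exists>!f. is_bottcher_coordinate m (fps_X ^ m * \<psi>) f"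
proof -
  define E where "E g = (g oo fps_X ^ m) - g ^ m * (\<psi> oo (fps_X * g))" for g
  \<comment> \<open>a Newton step with the constant derivative \<open>m\<close>: \<open>E g\<close> depends on \<open>g $ n\<close> through \<open>- m * g $ n\<close>\<close>
  define T where "T g = g + fps_const (1 / of_nat m) * E g" for g
  have "\<exists>!g. g $ 0 = 1 \<and> T g = g"
  proof (rule fps_contraction_ex1_fixpoint)
    show "T g $ 0 = 1" if "g $ 0 = 1" for g
      using m that by (simp add: T_def E_def fps_power_zeroth \<psi>0)
    fix g h :: "'a fps" and n :: nat
    assume gh: "g $ 0 = 1" "h $ 0 = 1" "0 < n" "\<And>k. k < n \<Longrightarrow> g $ k = h $ k"
    let ?P = "\<lambda>g. \<psi> oo (fps_X * g)"
    have "g ^ m * ?P g - h ^ m * ?P h = (g ^ m - h ^ m) * ?P g + (?P g - ?P h) * h ^ m"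
      by (simp add: algebra_simps)
    moreover have "((g ^ m - h ^ m) * ?P g) $ n = of_nat m * (g $ n - h $ n)"
      using fps_power_diff_nth[of g h n _ m] gh
      by (subst fps_mult_nth_lowest) (auto simp: \<psi>0)
    moreover have "((?P g - ?P h) * h ^ m) $ n = 0"
      using fps_compose_X_mult_cong[of g h n _ \<psi>] gh
      \<comment> \<open>The compositions agree up to and including index \<open>n\<close>, hence the
        bound \<open>Suc n\<close>.\<close>
      by (intro fps_mult_nth_below[of "Suc n"]) auto
    \<comment> \<open>This coefficient is 0 or has index \<open>n div m\<close>, which is below
      \<open>n\<close> because \<open>2 \<le> m\<close> and \<open>0 < n\<close>.\<close>
    moreover have "(g oo fps_X ^ m) $ n = (h oo fps_X ^ m) $ n"
      using m gh by (auto simp: fps_nth_compose_X_power)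
    ultimately have "E g $ n - E h $ n = - (of_nat m * (g $ n - h $ n))"
      unfolding E_def by (simp add: algebra_simps)
    then show "T g $ n = T h $ n"
      using m by (simp add: T_def field_simps)
  qed
  moreover have "T g = g \<longleftrightarrow> g ^ m * (\<psi> oo (fps_X * g)) = g oo fps_X ^ m" for g
    using m by (auto simp: T_def E_def)
  ultimately have ex1: "\<exists>!g. is_bottcher_coordinate m (fps_X ^ m * \<psi>) (fps_X * g)"
    using m by (simp add: is_bottcher_coordinate_fps_X_mult_iff)
  have "\<exists>g. f = fps_X * g" if "f $ 0 = 0" for f :: "'a fps"
    using that by (intro exI[of _ "fps_shift 1 f"]) (auto simp: fps_eq_iff)
  then have "\<exists>g. f = fps_X * g" if "is_bottcher_coordinate m (fps_X ^ m * \<psi>) f" for f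
    using that by (simp add: is_bottcher_coordinate_def)
  with ex1 show ?thesis
    by metis
qed

section \<open>Coefficients with respect to \<open>x^n/n!\<close>\<close>

text \<open>In this normalisation products and derivatives have integer weights, so integrality and
  congruences propagate without division.\<close>

definition egf_coeff :: "'a::field_char_0 fps \<Rightarrow> nat \<Rightarrow> 'a" where
  "egf_coeff F n = fact n * F $ n"

lemma egf_coeff_mult:
  "egf_coeff (F * G) n = (\<Sum>i\<le>n. of_nat (n choose i) * egf_coeff F i * egf_coeff G (n - i))"
  unfolding egf_coeff_def fps_mult_nth sum_distrib_left atLeast0AtMost
  by (intro sum.cong refl) (simp add: binomial_fact field_simps)

lemma egf_coeff_deriv: "egf_coeff (fps_deriv F) n = egf_coeff F (Suc n)"
  by (simp add: egf_coeff_def algebra_simps)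

lemma egf_coeff_fps_X_mult:
  "egf_coeff (fps_X * F) n = of_nat n * egf_coeff F (n - 1)"
  by (cases n) (simp_all add: egf_coeff_def algebra_simps)

lemma egf_coeff_add: "egf_coeff (F + G) n = egf_coeff F n + egf_coeff G n"
  by (simp add: egf_coeff_def algebra_simps)

lemma egf_coeff_minus: "egf_coeff (- F) n = - egf_coeff F n"
  by (simp add: egf_coeff_def)

lemma egf_coeff_of_nat_mult: "egf_coeff (of_nat c * F) n = of_nat c * egf_coeff F n"
  by (simp add: egf_coeff_def fps_of_nat[symmetric])

section \<open>The series \<open>G = exp (- x G)\<close> and its coefficients\<close>

text \<open>Up to sign, the number of labelled trees on \<open>n + 1\<close> vertices (Cayley). At
  \<open>n = 0\<close> the truncated exponent is 0 and the value is 1.\<close>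

definition abel_coeff :: "nat \<Rightarrow> int" where
  "abel_coeff n = (-1) ^ n * int (n + 1) ^ (n - 1)"

text \<open>The witness is \<open>G = exp (- W)\<close> with the Lambert series \<open>W\<close>,
  defined by \<open>W * exp W = x\<close>. Then \<open>W = x G\<close>, and differentiating
  \<open>G = exp (- x G)\<close> gives the equation.\<close>

lemma ex_tree_series:
  "\<exists>G :: 'a::field_char_0 fps. G $ 0 = 1 \<and> fps_deriv G = - G * fps_deriv (fps_X * G)"
proof -
  define V :: "'a fps" where "V = fps_X * fps_exp 1"
  define W where "W = fps_inv V"
  define Z where "Z = fps_exp 1 oo W"
  have W0: "W $ 0 = 0"
    by (simp add: W_def fps_inv_def)
  have Z0: "Z $ 0 = 1"
    by (simp add: Z_def)
  have "V oo W = fps_X"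
    unfolding W_def by (rule fps_inv_right) (simp_all add: V_def)
  then have "W * Z = fps_X"
    by (simp add: V_def Z_def fps_compose_mult_distrib W0)
  then have W: "fps_X * inverse Z = W"
    using Z0 by (metis inverse_mult_eq_1' mult.assoc mult.right_neutral zero_neq_one)
  have "fps_deriv Z = Z * fps_deriv W"
    unfolding Z_def by (simp add: fps_compose_deriv W0)
  then have "fps_deriv (inverse Z) = - (Z * inverse Z) * inverse Z * fps_deriv W"
    using Z0 by (simp add: fps_inverse_deriv power2_eq_square)
  then have "fps_deriv (inverse Z) = - inverse Z * fps_deriv (fps_X * inverse Z)"
    using Z0 by (simp add: W inverse_mult_eq_1')
  then show ?thesis
    using Z0 by (intro exI[of _ "inverse Z"]) simp
qed

text \<open>
  Since \<open>(G^t)' = - t G^(t+1) - t/(t+1) x (G^(t+1))'\<close>, the coefficient of index \<open>n + 1\<close> of \<open>G^t\<close> is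
  a multiple of the one of index \<open>n\<close> of \<open>G^(t+1)\<close>; this replaces Abel's identity or Lagrange inversion.
\<close>

lemma egf_coeff_tree_series_power:
  fixes G :: "'a::field_char_0 fps"
  assumes G0: "G $ 0 = 1" and G': "fps_deriv G = - G * fps_deriv (fps_X * G)"
  shows "egf_coeff (G ^ t) (Suc n) = (-1) ^ Suc n * of_nat t * of_nat (t + Suc n) ^ n"
proof -
  have rec: "egf_coeff (G ^ t) (Suc n) =
      - of_nat t * of_nat (t + Suc n) / of_nat (Suc t) * egf_coeff (G ^ Suc t) n" for t n
  proof -
    have "of_nat (Suc t) * fps_deriv (G ^ t) =
          - (of_nat t * (of_nat (Suc t) * G ^ Suc t + fps_X * fps_deriv (G ^ Suc t)))"
    proof (cases t)
      case (Suc s)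
      have "fps_deriv (G ^ t) = of_nat t * G ^ s * fps_deriv G"
        unfolding Suc fps_deriv_power' by (simp add: mult_ac)
      also have "\<dots> = - of_nat t * G ^ t * (G + fps_X * fps_deriv G)"
        by (subst G') (simp add: Suc algebra_simps)
      finally have 1: "fps_deriv (G ^ t) = - of_nat t * G ^ t * (G + fps_X * fps_deriv G)" .
      have 2: "fps_deriv (G ^ Suc t) = of_nat (Suc t) * G ^ t * fps_deriv G"
        unfolding fps_deriv_power' by (simp add: mult_ac del: of_nat_Suc)
      show ?thesis
        unfolding 1 2 by (simp add: algebra_simps)
    qed simp
    from arg_cong[OF this, of "\<lambda>F. egf_coeff F n"]
    have "of_nat (Suc t) * egf_coeff (G ^ t) (Suc n) =
        - (of_nat t * (of_nat (Suc t) * egf_coeff (G ^ Suc t) n +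
             of_nat n * egf_coeff (G ^ Suc t) (Suc (n - 1))))"
      unfolding egf_coeff_add egf_coeff_minus egf_coeff_of_nat_mult egf_coeff_deriv
        egf_coeff_fps_X_mult .
    \<comment> \<open>At \<open>n = 0\<close> the index \<open>Suc (n - 1)\<close> is not
      \<open>n\<close>, but its factor is 0; otherwise the two terms combine.\<close>
    also have "\<dots> = - of_nat t * of_nat (t + Suc n) * egf_coeff (G ^ Suc t) n"
      by (cases n) (simp_all add: algebra_simps)
    finally have "of_nat (Suc t) * egf_coeff (G ^ t) (Suc n) =
        - of_nat t * of_nat (t + Suc n) * egf_coeff (G ^ Suc t) n" .
    moreover have "egf_coeff (G ^ t) (Suc n) =
        of_nat (Suc t) * egf_coeff (G ^ t) (Suc n) / of_nat (Suc t)"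
      by (simp del: of_nat_Suc)
    ultimately show ?thesis
      by simp
  qed
  show ?thesis
  \<comment> \<open>Each use of \<open>rec\<close> raises \<open>t\<close> and lowers
    \<open>n\<close>, so \<open>t + Suc n\<close> is invariant and accumulates to a power, while the
    quotients \<open>t / (t + 1)\<close> telescope.\<close>
  proof (induction n arbitrary: t)
    case 0
    have "egf_coeff (G ^ Suc t) 0 = 1"
      by (simp add: egf_coeff_def fps_power_zeroth G0)
    then show ?case
      by (subst rec) (simp add: divide_simps del: of_nat_Suc)
  next
    case (Suc n)
    show ?case
      by (subst rec, subst Suc.IH) (simp add: field_simps del: of_nat_Suc)
  qed
qed

lemma egf_coeff_tree_series:
  fixes G :: "'a::field_char_0 fps"
  assumes "G $ 0 = 1" "fps_deriv G = - G * fps_deriv (fps_X * G)"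
  shows "egf_coeff G n = of_int (abel_coeff n)"
proof (cases n)
  case (Suc k)
  then show ?thesis
    using egf_coeff_tree_series_power[OF assms, of 1 k] by (simp add: abel_coeff_def)
qed (simp add: egf_coeff_def abel_coeff_def assms)

text \<open>Comparison of coefficients in \<open>G' = - G (x G)'\<close>. It is the recursion that
  the Boettcher coefficients satisfy modulo \<open>p\<close>.\<close>

lemma abel_coeff_Suc:
  "abel_coeff (Suc n) =
     (\<Sum>i\<le>n. int (n choose i) * abel_coeff i * (- int (Suc (n - i)) * abel_coeff (n - i)))"
proof -
  obtain G :: "rat fps" where G: "G $ 0 = 1" "fps_deriv G = - G * fps_deriv (fps_X * G)"
    using ex_tree_series by blast
  have "egf_coeff (fps_deriv G) n = egf_coeff (G * - fps_deriv (fps_X * G)) n"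
    using G(2) by (simp only: mult_minus_left mult_minus_right)
  moreover have "egf_coeff (- fps_deriv (fps_X * G)) k = - of_nat (Suc k) * egf_coeff G k" for k
    unfolding egf_coeff_minus egf_coeff_deriv egf_coeff_fps_X_mult by (simp del: of_nat_Suc)
  ultimately have "(of_int (abel_coeff (Suc n)) :: rat) =
      of_int (\<Sum>i\<le>n. int (n choose i) * abel_coeff i * (- int (Suc (n - i)) * abel_coeff (n - i)))"
    unfolding egf_coeff_deriv egf_coeff_mult by (simp add: egf_coeff_tree_series[OF G] del: of_nat_Suc)
  then show ?thesis
    by (simp only: of_int_eq_iff)
qed

section \<open>Congruences for integers embedded in a ring of characteristic 0\<close>

text \<open>Integrality of \<open>x\<close> is part of the predicate, so one induction yields both
  integrality and the residue.\<close>

definition int_cong :: "int \<Rightarrow> 'a::ring_char_0 \<Rightarrow> int \<Rightarrow> bool" where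
  "int_cong p x c \<longleftrightarrow> (\<exists>d. x = of_int d \<and> [d = c] (mod p))"

lemma int_cong_of_int: "int_cong p (of_int c) c"
  by (auto simp: int_cong_def)

lemma int_cong_of_nat: "int_cong p (of_nat n) (int n)"
  using int_cong_of_int[of p "int n"] by simp

lemma int_cong_add: "int_cong p x c \<Longrightarrow> int_cong p y d \<Longrightarrow> int_cong p (x + y) (c + d)"
  unfolding int_cong_def by (metis of_int_add cong_add)

lemma int_cong_minus: "int_cong p x c \<Longrightarrow> int_cong p (- x) (- c)"
  unfolding int_cong_def by (metis of_int_minus cong_minus_minus_iff)

lemma int_cong_mult: "int_cong p x c \<Longrightarrow> int_cong p y d \<Longrightarrow> int_cong p (x * y) (c * d)"
  unfolding int_cong_def by (metis of_int_mult cong_mult)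

lemma int_cong_sum:
  "(\<And>i. i \<in> A \<Longrightarrow> int_cong p (f i) (c i)) \<Longrightarrow> int_cong p (\<Sum>i\<in>A. f i) (\<Sum>i\<in>A. c i)"
proof (induction A rule: infinite_finite_induct)
  case (insert i A)
  then show ?case
    by (simp add: int_cong_add)
qed (use int_cong_of_int[of p 0] in simp_all)

lemma int_cong_cong: "int_cong p x c \<Longrightarrow> [c = d] (mod p) \<Longrightarrow> int_cong p x d"
  unfolding int_cong_def by (metis cong_trans)

lemma int_cong_dvd_mult:
  assumes "p dvd int m" "int_cong p x c"
  shows "int_cong p (of_nat m * x) 0"
proof (rule int_cong_cong)
  show "int_cong p (of_nat m * x) (int m * c)"
    using assms(2) by (intro int_cong_mult int_cong_of_nat)
  show "[int m * c = 0] (mod p)"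
    using assms(1) by (simp add: cong_0_iff)
qed

section \<open>The Boettcher equation modulo \<open>p\<close>\<close>

text \<open>After differentiation every term carries the factor \<open>m g^m\<close>, also the one
  from \<open>1 + m x g\<close>; cancelling it leaves \<open>(x g)'\<close> without a factor
  \<open>m\<close>.\<close>

lemma bottcher_log_deriv:
  fixes g :: "'a::field_char_0 fps"
  defines "u \<equiv> fps_deriv g * inverse g"
  assumes m: "0 < m" and g0: "g $ 0 = 1"
    and eq: "g ^ m * (1 + of_nat m * (fps_X * g)) = g oo fps_X ^ m"
  shows "(1 + of_nat m * (fps_X * g)) * (u - fps_X ^ (m - 1) * (u oo fps_X ^ m)) =
           - fps_deriv (fps_X * g)"
proof -
  define f where "f = fps_X * g"
  have nz: "g \<noteq> 0"
    using g0 by auto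
  have gu: "fps_deriv g = g * u"
    using g0 by (simp add: u_def inverse_mult_eq_1' mult.left_commute)
  obtain k where k: "m = Suc k"
    using m gr0_implies_Suc by blast
  have 1: "fps_deriv (g ^ m) = of_nat m * u * g ^ m"
    using fps_deriv_power'[of g m] by (simp add: gu k mult_ac del: of_nat_Suc)
  have 2: "fps_deriv (fps_X ^ m :: 'a fps) = of_nat m * fps_X ^ (m - 1)"
    using fps_deriv_power'[of fps_X m] by simp
  have "fps_deriv (g ^ m * (1 + of_nat m * f)) =
        of_nat m * g ^ m * ((1 + of_nat m * f) * u + fps_deriv f)"
    by (simp add: 1 algebra_simps)
  moreover have "fps_deriv (g oo fps_X ^ m) =
      (g oo fps_X ^ m) * (u oo fps_X ^ m) * (of_nat m * fps_X ^ (m - 1))"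
    using m by (simp add: fps_compose_deriv gu fps_compose_mult_distrib 2)
  \<comment> \<open>The functional equation, read from right to left, exposes the common
    factor.\<close>
  moreover have "\<dots> = of_nat m * g ^ m * ((1 + of_nat m * f) * (fps_X ^ (m - 1) * (u oo fps_X ^ m)))"
    by (simp add: eq[symmetric] f_def mult_ac)
  ultimately have "of_nat m * g ^ m * ((1 + of_nat m * f) * u + fps_deriv f) =
      of_nat m * g ^ m * ((1 + of_nat m * f) * (fps_X ^ (m - 1) * (u oo fps_X ^ m)))"
    using eq unfolding f_def by metis
  then have "(1 + of_nat m * f) * u + fps_deriv f =
      (1 + of_nat m * f) * (fps_X ^ (m - 1) * (u oo fps_X ^ m))"
    using nz m by (simp only: mult_cancel_left) simp
  then show ?thesis
    unfolding f_def[symmetric] by (simp add: algebra_simps eq_neg_iff_add_eq_0)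
qed

text \<open>Only indices \<open>n = m k + (m - 1)\<close> occur. There \<open>p + k \<le> n\<close>,
  so \<open>p! k!\<close> divides \<open>n!\<close>, and \<open>n!/k!\<close> is a multiple of
  \<open>p\<close>. Only \<open>k < n\<close> is involved, as strong induction demands.\<close>

lemma int_cong_egf_coeff_compose_X_power:
  fixes u :: "'a::field_char_0 fps"
  assumes "1 < p" "p < m" and u: "\<And>k. k < n \<Longrightarrow> int_cong (int p) (egf_coeff u k) (c k)"
  shows "int_cong (int p) (egf_coeff (fps_X ^ (m - 1) * (u oo fps_X ^ m)) n) 0"
proof (cases "m - 1 \<le> n \<and> m dvd n - (m - 1)")
  case True
  then obtain k where "n - (m - 1) = m * k"
    by blast
  with True have n: "n = m * k + (m - 1)"
    by linarith
  have "k \<le> m * k"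
    using assms by simp
  then have "k < n" "p + k \<le> n"
    using n assms(1,2) by linarith+
  have "p * fact k dvd fact p * (fact k :: nat)"
    using assms(1) by (intro mult_dvd_mono dvd_fact dvd_refl) auto
  also have "\<dots> dvd fact (p + k)"
    by (rule fact_fact_dvd_fact)
  also have "\<dots> dvd fact n"
    using \<open>p + k \<le> n\<close> by (rule fact_dvd)
  finally obtain e where e: "fact n = p * fact k * e"
    by blast
  have "egf_coeff (fps_X ^ (m - 1) * (u oo fps_X ^ m)) n = of_nat (fact n) * u $ k"
    using n assms by (simp add: egf_coeff_def fps_X_power_mult_nth fps_nth_compose_X_power)
  also have "\<dots> = of_nat (p * e) * egf_coeff u k"
    by (simp only: e egf_coeff_def) (simp add: mult_ac)
  finally show ?thesis
    using int_cong_dvd_mult[OF _ u[OF \<open>k < n\<close>], of "p * e"] by simp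
next
  case False
  then have "egf_coeff (fps_X ^ (m - 1) * (u oo fps_X ^ m)) n = 0"
    using assms by (auto simp: egf_coeff_def fps_X_power_mult_nth fps_nth_compose_X_power)
  then show ?thesis
    using int_cong_of_int[of "int p" 0] by simp
qed

text \<open>Simultaneous strong induction on \<open>g\<close>, \<open>u\<close> and
  \<open>v = u - w\<close>: index \<open>n\<close> of \<open>g\<close> comes from lower indices of
  \<open>g\<close> and \<open>u\<close>, then \<open>v\<close> from \<open>g\<close> and lower
  \<open>v\<close>, and finally \<open>u = v + w\<close> with \<open>w\<close> vanishing modulo
  \<open>p\<close>.\<close>

lemma bottcher_egf_coeff_cong:
  fixes g :: "'a::field_char_0 fps"
  assumes p: "1 < p" "p < m" "p dvd m" and g0: "g $ 0 = 1"
    and eq: "g ^ m * (1 + of_nat m * (fps_X * g)) = g oo fps_X ^ m"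
  shows "int_cong (int p) (egf_coeff g n) (abel_coeff n)"
proof -
  define u where "u = fps_deriv g * inverse g"
  define w where "w = fps_X ^ (m - 1) * (u oo fps_X ^ m)"
  define v where "v = u - w"
  \<comment> \<open>The coefficients of \<open>- (x G)'\<close>, the logarithmic derivative of the
    comparison series \<open>G\<close>.\<close>
  define c where "c n = - int (Suc n) * abel_coeff n" for n
  have "fps_deriv g = g * u"
    using g0 by (simp add: u_def inverse_mult_eq_1' mult.left_commute)
  then have g_Suc: "egf_coeff g (Suc n) =
      (\<Sum>i\<le>n. of_nat (n choose i) * egf_coeff g i * egf_coeff u (n - i))" for n
    by (simp add: egf_coeff_mult flip: egf_coeff_deriv)
  have "(1 + of_nat m * (fps_X * g)) * v = - fps_deriv (fps_X * g)"
    using bottcher_log_deriv[OF _ g0 eq] p by (simp add: u_def v_def w_def)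
  \<comment> \<open>On the right \<open>v\<close> appears only with the factor \<open>m x g\<close>,
    which makes this a recursion for \<open>v\<close> whose correction vanishes modulo
    \<open>p\<close>.\<close>
  then have v_eq: "v = - fps_deriv (fps_X * g) + - (of_nat m * (fps_X * g * v))"
    by (simp add: algebra_simps)
  have v_coeff: "egf_coeff v n = of_int (- int (Suc n)) * egf_coeff g n +
      - (of_nat m * (\<Sum>i\<le>n. of_nat (n choose i) * (of_nat i * egf_coeff g (i - 1)) *
           egf_coeff v (n - i)))" for n
  proof -
    have "egf_coeff v n = egf_coeff (- fps_deriv (fps_X * g) + - (of_nat m * (fps_X * g * v))) n"
      by (rule arg_cong[OF v_eq])
    also have "\<dots> = of_int (- int (Suc n)) * egf_coeff g n +
      - (of_nat m * (\<Sum>i\<le>n. of_nat (n choose i) * (of_nat i * egf_coeff g (i - 1)) *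
           egf_coeff v (n - i)))"
      unfolding egf_coeff_add egf_coeff_minus egf_coeff_deriv egf_coeff_of_nat_mult
        egf_coeff_mult[of _ v] egf_coeff_fps_X_mult by (simp del: of_nat_Suc)
    finally show ?thesis .
  qed
  have "int_cong p (egf_coeff g n) (abel_coeff n) \<and> int_cong p (egf_coeff u n) (c n)
      \<and> int_cong p (egf_coeff v n) (c n)" for n
  proof (induction n rule: less_induct)
    case (less n)
    have g: "int_cong p (egf_coeff g n) (abel_coeff n)"
    proof (cases n)
      case 0
      then show ?thesis
        using int_cong_of_int[of p 1] g0 by (simp add: egf_coeff_def abel_coeff_def)
    next
      case (Suc k)
      show ?thesis
        unfolding Suc g_Suc abel_coeff_Suc c_def[symmetric]
        using less Suc by (intro int_cong_sum int_cong_mult int_cong_of_nat) auto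
    qed
    let ?t = "\<lambda>i. of_nat (n choose i) * (of_nat i * egf_coeff g (i - 1)) * egf_coeff v (n - i)"
    have "int_cong p (?t i) (int (n choose i) * (int i * abel_coeff (i - 1)) * c (n - i))" if "i \<le> n" for i
    \<comment> \<open>The summand \<open>i = 0\<close> contains \<open>egf_coeff v n\<close>, which
      is not yet available; its factor \<open>of_nat i\<close> removes it.\<close>
    proof (cases "i = 0")
      case True
      then show ?thesis using int_cong_of_int[of p 0] by simp
    next
      case False
      then show ?thesis
        using less that by (intro int_cong_mult int_cong_of_nat) auto
    qed
    then have "int_cong p (\<Sum>i\<le>n. ?t i) (\<Sum>i\<le>n. int (n choose i) * (int i * abel_coeff (i - 1)) * c (n - i))"
      by (intro int_cong_sum) auto
    then have "int_cong p (of_nat m * (\<Sum>i\<le>n. ?t i)) 0"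
      using p by (intro int_cong_dvd_mult) auto
    from int_cong_add[OF int_cong_mult[OF int_cong_of_int g] int_cong_minus[OF this], of "- int (Suc n)"]
    have v: "int_cong p (egf_coeff v n) (c n)"
      by (subst v_coeff) (simp only: c_def minus_zero add_0_right)
    have "int_cong p (egf_coeff w n) 0"
      unfolding w_def using p less by (intro int_cong_egf_coeff_compose_X_power) auto
    from int_cong_add[OF v this] have "int_cong p (egf_coeff u n) (c n)"
      by (simp add: v_def flip: egf_coeff_add)
    with g v show ?case
      by blast
  qed
  then show ?thesis
    by blast
qed

section \<open>Prime power indices and the conclusion\<close>

text \<open>For \<open>r > 0\<close> the base \<open>p ^ r + 1\<close> is 1 modulo \<open>p\<close>,
  so only the sign remains; for \<open>p = 2\<close> the sign is 1, which equals -1 modulo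
  2.\<close>

lemma abel_coeff_prime_power:
  assumes "prime p"
  shows "[abel_coeff (p ^ r) = - 1] (mod int p)"
proof (cases "r = 0")
  case True
  then show ?thesis by (simp add: abel_coeff_def)
next
  case False
  have "[int (p ^ r + 1) = 0 + 1] (mod int p)"
    unfolding of_nat_add using False by (intro cong_add) (auto simp: cong_0_iff)
  then have "[int (p ^ r + 1) ^ (p ^ r - 1) = 1 ^ (p ^ r - 1)] (mod int p)"
    by (intro cong_pow) simp
  moreover have "[(- 1) ^ (p ^ r) = - 1] (mod int p)"
  proof (cases "p = 2")
    case True
    then show ?thesis
      using False by (simp add: cong_def)
  next
    case False
    then have "odd (p ^ r)"
      using assms prime_odd_nat prime_ge_2_nat[of p] by force
    then show ?thesis
      by simp
  qed
  ultimately show ?thesis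
    unfolding abel_coeff_def using cong_mult by fastforce
qed

theorem theorem5:
  fixes p r :: nat and \<phi> f :: "rat fps" and a :: "nat \<Rightarrow> rat"
  assumes "prime p"
    and "\<phi> = fps_X ^ (p\<^sup>2) + of_nat (p\<^sup>2) * fps_X ^ (p\<^sup>2 + 1)"
    and "f = bottcher_coordinate (p\<^sup>2) \<phi>"
    and "f = fps_X * Abs_fps (\<lambda>k. a k / fact k)"
  shows "\<exists>c::int. a (p ^ r) = of_int c \<and> [c = -1] (mod int p)"
proof -
  define m where "m = p\<^sup>2"
  define g where "g = Abs_fps (\<lambda>k. a k / fact k)"
  define \<psi> :: "rat fps" where "\<psi> = 1 + of_nat m * fps_X"
  have "1 < p"
    using assms(1) by (rule prime_gt_1_nat)
  then have p: "1 < p" "p < m" "p dvd m"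
    by (simp_all add: m_def power2_eq_square)
  have \<phi>: "\<phi> = fps_X ^ m * \<psi>"
    by (simp add: assms(2) m_def \<psi>_def algebra_simps)
  have "\<exists>!f. is_bottcher_coordinate m \<phi> f"
    unfolding \<phi> using p by (intro bottcher_coordinate_ex1) (auto simp: \<psi>_def)
  then have "is_bottcher_coordinate m \<phi> (bottcher_coordinate m \<phi>)"
    unfolding bottcher_coordinate_def by (rule theI')
  then have "is_bottcher_coordinate m (fps_X ^ m * \<psi>) (fps_X * g)"
    using assms(3,4) by (simp add: m_def g_def \<phi>)
  then have g: "g $ 0 = 1" "g ^ m * (\<psi> oo (fps_X * g)) = g oo fps_X ^ m"
    using p by (simp_all add: is_bottcher_coordinate_fps_X_mult_iff)
  have "\<psi> oo (fps_X * g) = 1 + of_nat m * (fps_X * g)"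
    by (simp add: \<psi>_def fps_compose_add_distrib fps_compose_mult_distrib flip: fps_of_nat)
  with g have "int_cong (int p) (egf_coeff g (p ^ r)) (abel_coeff (p ^ r))"
    using p by (intro bottcher_egf_coeff_cong[of p m]) simp_all
  from int_cong_cong[OF this abel_coeff_prime_power[OF assms(1)]]
  show ?thesis
    by (simp add: int_cong_def egf_coeff_def g_def)
qed

end
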